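(* Let $(\mathcal{C},W)$ and $(\mathcal{C}',W')$ be two localizers, with localization functors $P:\mathcal{C}\to W^{-1}\mathcal{C}$ and $P':\mathcal{C}'\to W'^{-1}\mathcal{C}'$. Let $F:\mathcal{C}\to\mathcal{C}'$ and $G:\mathcal{C}'\to\mathcal{C}$ be a pair of adjoint functors, $F$ being left adjoint to $G$, with counit $\varepsilon:F\circ G\to 1_{\mathcal{C}'}$ and unit $\eta:1_{\mathcal{C}}\to G\circ F$. Suppose that $F$ has an absolute total left derived functor $(\mathbf{L}F,\alpha)$, where $\mathbf{L}F:W^{-1}\mathcal{C}\to W'^{-1}\mathcal{C}'$ and $\alpha:\mathbf{L}F\circ P\to P'\circ F$, and that $G$ has an absolute total right derived functor $(\mathbf{R}G,\beta)$, where $\mathbf{R}G:W'^{-1}\mathcal{C}'\to W^{-1}\mathcal{C}$ and $\beta:P\circ G\to \mathbf{R}G\circ P'$. Then $\mathbf{L}F$ and $\mathbf{R}G$ form a pair of adjoint functors, $\mathbf{L}F$ being left adjoint to $\mathbf{R}G$, and the counit and unit of this adjunction $$\underline{\varepsilon}:\mathbf{L}F\circ\mathbf{R}G\to 1_{W'^{-1}\mathcal{C}'},\qquad \underline{\eta}:1_{W^{-1}\mathcal{C}}\to\mathbf{R}G\circ\mathbf{L}F$$ can be chosen in such a way that $$(\underline{\varepsilon}\star P')(\mathbf{L}F\star\beta)=(P'\star\varepsilon)(\alpha\star G)\quad\text{as natural transformations } \mathbf{L}F\circ P\circ G\to P',$$ $$(\mathbf{R}G\star\alpha)(\underline{\eta}\star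 P)=(\beta\star F)(P\star\eta)\quad\text{as natural transformations } P\to\mathbf{R}G\circ P'\circ F.$$
   Context: Notation: $\star$ denotes whiskering (horizontal composition) of a natural transformation with a functor, and juxtaposition denotes vertical composition of natural transformations. Localization: for a category $\mathcal{C}$ and a class $W$ of arrows of $\mathcal{C}$, the localization functor $P:\mathcal{C}\to W^{-1}\mathcal{C}$ sends arrows of $W$ to isomorphisms and is universal for this property: for every functor $F:\mathcal{C}\to\mathcal{D}$ sending arrows of $W$ to isomorphisms there is a unique functor $\widetilde F:W^{-1}\mathcal{C}\to\mathcal{D}$ with $F=\widetilde F P$. A localizer is a pair $(\mathcal{C},W)$, where $\mathcal{C}$ is a category and $W$ a class of arrows of $\mathcal{C}$, such that $W^{-1}\mathcal{C}$ is locally small. Derived functors: let $(\mathcal{C},W)$ be a localizer with localization functor $P:\mathcal{C}\to W^{-1}\mathcal{C}$, and let $K:\mathcal{C}\to\mathcal{D}$ be a functor. A right derived functor of $K$ is a pair $(\mathsf{R}K,\alpha)$, with $\mathsf{R}K:W^{-1}\mathcal{C}\to\mathcal{D}$ a functor and $\alpha:K\to\mathsf{R}K\circ P$ a natural transformation, such that for every functor $T:W^{-1}\mathcal{C}\to\mathcal{D}$ and every natural transformation $\gamma:K\to T\circ P$ there is a unique natural transformation $\delta:\mathsf{R}K\to T$ with $\gamma=(\delta\star P)\alpha$. It is an absolute right derived functor of $K$ if for every functor $H:\mathcal{D}\to\mathcal{E}$ the pair $(H\circ\mathsf{R}K,H\star\alpha)$ is a right derived functor of $H\circ K$. Dually,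 a left derived functor of $K$ is a pair $(\mathsf{L}K,\alpha)$, with $\mathsf{L}K:W^{-1}\mathcal{C}\to\mathcal{D}$ a functor and $\alpha:\mathsf{L}K\circ P\to K$ a natural transformation, such that for every functor $T:W^{-1}\mathcal{C}\to\mathcal{D}$ and every natural transformation $\gamma:T\circ P\to K$ there is a unique natural transformation $\delta:T\to\mathsf{L}K$ with $\gamma=\alpha(\delta\star P)$. It is an absolute left derived functor of $K$ if for every functor $H:\mathcal{D}\to\mathcal{E}$ the pair $(H\circ\mathsf{L}K,H\star\alpha)$ is a left derived functor of $H\circ K$. Total derived functors: for localizers $(\mathcal{C},W)$, $(\mathcal{C}',W')$ with localization functors $P,P'$ and a functor $F:\mathcal{C}\to\mathcal{C}'$, an absolute total left (resp. right) derived functor of $F$ is an absolute left (resp. right) derived functor of $P'\circ F:\mathcal{C}\to W'^{-1}\mathcal{C}'$. *)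

theory Defs
  imports Main "HOL-Library.FuncSet" "HOL-Library.Equipollence"
begin

text \<open>
  HOL cannot quantify over types inside a formula, so all categories that occur together have
  objects in one type \<open>'o\<close> and arrows in one type \<open>'m\<close>. The type \<open>'m\<close> plays the role of the
  universe: classes of arrows are subsets of \<open>'m\<close>, and a class is a (small) set iff it has
  strictly smaller cardinality than \<open>'m\<close> (limitation of size). In the universal properties below,
  \<open>every category\<close> means every category of this type. For infinite \<open>'o\<close> and \<open>'m\<close> this is no
  restriction: the functors and transformations that occur in one instance of a universal property
  all live in the subcategory of the test category generated by their values, and that subcategory
  is again small enough for these types.

  Functors and natural transformations are functions that are \<open>undefined\<close> outside the objects and
  arrows of their source. Hence equality of functors and of natural transformations is HOL equality.
\<close>

section \<open>Categories, functors and natural transformations\<close>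

record ('o, 'm) category =
  Obj :: "'o set"
  Arr :: "'m set"
  Dom :: "'m \<Rightarrow> 'o"
  Cod :: "'m \<Rightarrow> 'o"
  Id :: "'o \<Rightarrow> 'm"
  Comp :: "'m \<Rightarrow> 'm \<Rightarrow> 'm"  (infixl \<open>\<cdot>\<index>\<close> 70)

definition hom :: "('o, 'm) category \<Rightarrow> 'o \<Rightarrow> 'o \<Rightarrow> 'm set" where
  "hom C x y = {f \<in> Arr C. Dom C f = x \<and> Cod C f = y}"

locale category =
  fixes C :: "('o, 'm) category" (structure)
  assumes Dom_closed: "f \<in> Arr C \<Longrightarrow> Dom C f \<in> Obj C"
    and Cod_closed: "f \<in> Arr C \<Longrightarrow> Cod C f \<in> Obj C"
    and Id_closed: "x \<in> Obj C \<Longrightarrow> Id C x \<in> hom C x x"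
    and Comp_closed: "\<lbrakk>g \<in> hom C y z; f \<in> hom C x y\<rbrakk> \<Longrightarrow> g \<cdot> f \<in> hom C x z"
    and Id_left: "f \<in> hom C x y \<Longrightarrow> Id C y \<cdot> f = f"
    and Id_right: "f \<in> hom C x y \<Longrightarrow> f \<cdot> Id C x = f"
    and Comp_assoc: "\<lbrakk>h \<in> hom C z w; g \<in> hom C y z; f \<in> hom C x y\<rbrakk>
                      \<Longrightarrow> (h \<cdot> g) \<cdot> f = h \<cdot> (g \<cdot> f)"

definition is_iso :: "('o, 'm) category \<Rightarrow> 'm \<Rightarrow> bool" where
  "is_iso C f \<longleftrightarrow> f \<in> Arr C \<and>
     (\<exists>g \<in> hom C (Cod C f) (Dom C f).
        g \<cdot>\<^bsub>C\<^esub> f = Id C (Dom C f) \<and> f \<cdot>\<^bsub>C\<^esub> g = Id C (Cod C f))"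

definition locally_small :: "('o, 'm) category \<Rightarrow> bool" where
  "locally_small C \<longleftrightarrow> (\<forall>x \<in> Obj C. \<forall>y \<in> Obj C. hom C x y \<prec> (UNIV :: 'm set))"

record ('o, 'm) functor_data =
  OMap :: "'o \<Rightarrow> 'o"
  AMap :: "'m \<Rightarrow> 'm"

definition is_functor ::
    "('o, 'm) category \<Rightarrow> ('o, 'm) category \<Rightarrow> ('o, 'm) functor_data \<Rightarrow> bool" where
  "is_functor C D F \<longleftrightarrow>
     category C \<and> category D \<and>
     OMap F \<in> extensional (Obj C) \<and> AMap F \<in> extensional (Arr C) \<and>
     (\<forall>x \<in> Obj C. OMap F x \<in> Obj D) \<and>
     (\<forall>f \<in> Arr C. AMap F f \<in> hom D (OMap F (Dom C f)) (OMap F (Cod C f))) \<and>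
     (\<forall>x \<in> Obj C. AMap F (Id C x) = Id D (OMap F x)) \<and>
     (\<forall>g \<in> Arr C. \<forall>f \<in> Arr C. Dom C g = Cod C f \<longrightarrow>
        AMap F (g \<cdot>\<^bsub>C\<^esub> f) = AMap F g \<cdot>\<^bsub>D\<^esub> AMap F f)"

definition id_functor :: "('o, 'm) category \<Rightarrow> ('o, 'm) functor_data" (\<open>\<one>\<^bsub>_\<^esub>\<close>) where
  "\<one>\<^bsub>C\<^esub> = \<lparr>OMap = (\<lambda>x \<in> Obj C. x), AMap = (\<lambda>f \<in> Arr C. f)\<rparr>"

text \<open>In the following operations the subscript is the category on which the result is defined.\<close>

definition comp_functor ::
    "('o, 'm) functor_data \<Rightarrow> ('o, 'm) category \<Rightarrow> ('o, 'm) functor_data \<Rightarrow> ('o, 'm) functor_data"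
    (\<open>(_ \<circ>\<^bsub>_\<^esub> _)\<close> [55, 0, 56] 55) where
  "G \<circ>\<^bsub>C\<^esub> F = \<lparr>OMap = (\<lambda>x \<in> Obj C. OMap G (OMap F x)), AMap = (\<lambda>f \<in> Arr C. AMap G (AMap F f))\<rparr>"

definition nat_trans ::
    "('o, 'm) category \<Rightarrow> ('o, 'm) category \<Rightarrow> ('o, 'm) functor_data \<Rightarrow> ('o, 'm) functor_data
      \<Rightarrow> ('o \<Rightarrow> 'm) \<Rightarrow> bool" where
  "nat_trans C D S T \<tau> \<longleftrightarrow>
     is_functor C D S \<and> is_functor C D T \<and>
     \<tau> \<in> extensional (Obj C) \<and>
     (\<forall>x \<in> Obj C. \<tau> x \<in> hom D (OMap S x) (OMap T x)) \<and>
     (\<forall>f \<in> Arr C. \<tau> (Cod C f) \<cdot>\<^bsub>D\<^esub> AMap S f = AMap T f \<cdot>\<^bsub>D\<^esub> \<tau> (Dom C f))"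

definition id_trans ::
    "('o, 'm) category \<Rightarrow> ('o, 'm) category \<Rightarrow> ('o, 'm) functor_data \<Rightarrow> ('o \<Rightarrow> 'm)" where
  "id_trans C D S = (\<lambda>x \<in> Obj C. Id D (OMap S x))"

text \<open>Vertical composition of transformations between functors from \<open>C\<close> to \<open>D\<close>.\<close>

definition vcomp :: "('o \<Rightarrow> 'm) \<Rightarrow> ('o, 'm) category \<Rightarrow> ('o, 'm) category \<Rightarrow> ('o \<Rightarrow> 'm) \<Rightarrow> ('o \<Rightarrow> 'm)"
    (\<open>(_ \<bullet>\<^bsub>_,_\<^esub> _)\<close> [60, 0, 0, 61] 60) where
  "\<sigma> \<bullet>\<^bsub>C,D\<^esub> \<tau> = (\<lambda>x \<in> Obj C. \<sigma> x \<cdot>\<^bsub>D\<^esub> \<tau> x)"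

text \<open>The two whiskerings \<open>H \<star> \<tau>\<close> (functor applied after) and \<open>\<tau> \<star> P\<close> (functor applied before).\<close>

definition whisker_left :: "('o, 'm) functor_data \<Rightarrow> ('o, 'm) category \<Rightarrow> ('o \<Rightarrow> 'm) \<Rightarrow> ('o \<Rightarrow> 'm)"
    (\<open>(_ \<star>L\<^bsub>_\<^esub> _)\<close> [65, 0, 66] 65) where
  "H \<star>L\<^bsub>C\<^esub> \<tau> = (\<lambda>x \<in> Obj C. AMap H (\<tau> x))"

definition whisker_right :: "('o \<Rightarrow> 'm) \<Rightarrow> ('o, 'm) category \<Rightarrow> ('o, 'm) functor_data \<Rightarrow> ('o \<Rightarrow> 'm)"
    (\<open>(_ \<star>R\<^bsub>_\<^esub> _)\<close> [65, 0, 66] 65) where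
  "\<tau> \<star>R\<^bsub>C\<^esub> P = (\<lambda>x \<in> Obj C. \<tau> (OMap P x))"

text \<open>\<open>F : C \<rightarrow> D\<close> is left adjoint to \<open>G : D \<rightarrow> C\<close> with unit \<open>\<eta>\<close> and counit \<open>\<epsilon>\<close>.\<close>

definition adjunction ::
    "('o, 'm) category \<Rightarrow> ('o, 'm) category \<Rightarrow> ('o, 'm) functor_data \<Rightarrow> ('o, 'm) functor_data
      \<Rightarrow> ('o \<Rightarrow> 'm) \<Rightarrow> ('o \<Rightarrow> 'm) \<Rightarrow> bool" where
  "adjunction C D F G \<eta> \<epsilon> \<longleftrightarrow>
     is_functor C D F \<and> is_functor D C G \<and>
     nat_trans C C \<one>\<^bsub>C\<^esub> (G \<circ>\<^bsub>C\<^esub> F) \<eta> \<and>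
     nat_trans D D (F \<circ>\<^bsub>D\<^esub> G) \<one>\<^bsub>D\<^esub> \<epsilon> \<and>
     (\<epsilon> \<star>R\<^bsub>C\<^esub> F) \<bullet>\<^bsub>C,D\<^esub> (F \<star>L\<^bsub>C\<^esub> \<eta>) = id_trans C D F \<and>
     (G \<star>L\<^bsub>D\<^esub> \<epsilon>) \<bullet>\<^bsub>D,C\<^esub> (\<eta> \<star>R\<^bsub>D\<^esub> G) = id_trans D C G"

section \<open>Localization\<close>

text \<open>\<open>P : C \<rightarrow> L\<close> is a localization functor of \<open>C\<close> at \<open>W\<close>, so that \<open>L\<close> is \<open>W\<^sup>-\<^sup>1C\<close>.\<close>

definition is_localization ::
    "('o, 'm) category \<Rightarrow> 'm set \<Rightarrow> ('o, 'm) category \<Rightarrow> ('o, 'm) functor_data \<Rightarrow> bool" where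
  "is_localization C W L P \<longleftrightarrow>
     W \<subseteq> Arr C \<and> is_functor C L P \<and> (\<forall>w \<in> W. is_iso L (AMap P w)) \<and>
     (\<forall>(D :: ('o, 'm) category) F. is_functor C D F \<and> (\<forall>w \<in> W. is_iso D (AMap F w)) \<longrightarrow>
        (\<exists>!F'. is_functor L D F' \<and> F = F' \<circ>\<^bsub>C\<^esub> P))"

text \<open>Localizations are unique up to isomorphism, and local smallness is invariant under
  isomorphism, so it does not matter which localization is used here.\<close>

definition localizer :: "('o, 'm) category \<Rightarrow> 'm set \<Rightarrow> bool" where
  "localizer C W \<longleftrightarrow>
     category C \<and> W \<subseteq> Arr C \<and> (\<exists>L P. is_localization C W L P \<and> locally_small L)"

section \<open>Derived functors\<close>

text \<open>\<open>P : C \<rightarrow> L\<close> is the localization functor and \<open>K : C \<rightarrow> D\<close> the functor to be derived.\<close>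

definition right_derived ::
    "('o, 'm) category \<Rightarrow> ('o, 'm) category \<Rightarrow> ('o, 'm) functor_data \<Rightarrow>
     ('o, 'm) category \<Rightarrow> ('o, 'm) functor_data \<Rightarrow> ('o, 'm) functor_data \<Rightarrow> ('o \<Rightarrow> 'm) \<Rightarrow> bool" where
  "right_derived C L P D K RK \<alpha> \<longleftrightarrow>
     is_functor C D K \<and> is_functor L D RK \<and> nat_trans C D K (RK \<circ>\<^bsub>C\<^esub> P) \<alpha> \<and>
     (\<forall>T \<gamma>. is_functor L D T \<and> nat_trans C D K (T \<circ>\<^bsub>C\<^esub> P) \<gamma> \<longrightarrow>
        (\<exists>!\<delta>. nat_trans L D RK T \<delta> \<and> \<gamma> = (\<delta> \<star>R\<^bsub>C\<^esub> P) \<bullet>\<^bsub>C,D\<^esub> \<alpha>))"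

definition left_derived ::
    "('o, 'm) category \<Rightarrow> ('o, 'm) category \<Rightarrow> ('o, 'm) functor_data \<Rightarrow>
     ('o, 'm) category \<Rightarrow> ('o, 'm) functor_data \<Rightarrow> ('o, 'm) functor_data \<Rightarrow> ('o \<Rightarrow> 'm) \<Rightarrow> bool" where
  "left_derived C L P D K LK \<alpha> \<longleftrightarrow>
     is_functor C D K \<and> is_functor L D LK \<and> nat_trans C D (LK \<circ>\<^bsub>C\<^esub> P) K \<alpha> \<and>
     (\<forall>T \<gamma>. is_functor L D T \<and> nat_trans C D (T \<circ>\<^bsub>C\<^esub> P) K \<gamma> \<longrightarrow>
        (\<exists>!\<delta>. nat_trans L D T LK \<delta> \<and> \<gamma> = \<alpha> \<bullet>\<^bsub>C,D\<^esub> (\<delta> \<star>R\<^bsub>C\<^esub> P)))"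

definition absolute_right_derived ::
    "('o, 'm) category \<Rightarrow> ('o, 'm) category \<Rightarrow> ('o, 'm) functor_data \<Rightarrow>
     ('o, 'm) category \<Rightarrow> ('o, 'm) functor_data \<Rightarrow> ('o, 'm) functor_data \<Rightarrow> ('o \<Rightarrow> 'm) \<Rightarrow> bool" where
  "absolute_right_derived C L P D K RK \<alpha> \<longleftrightarrow>
     right_derived C L P D K RK \<alpha> \<and>
     (\<forall>(E :: ('o, 'm) category) H. is_functor D E H \<longrightarrow>
        right_derived C L P E (H \<circ>\<^bsub>C\<^esub> K) (H \<circ>\<^bsub>L\<^esub> RK) (H \<star>L\<^bsub>C\<^esub> \<alpha>))"

definition absolute_left_derived ::
    "('o, 'm) category \<Rightarrow> ('o, 'm) category \<Rightarrow> ('o, 'm) functor_data \<Rightarrow>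
     ('o, 'm) category \<Rightarrow> ('o, 'm) functor_data \<Rightarrow> ('o, 'm) functor_data \<Rightarrow> ('o \<Rightarrow> 'm) \<Rightarrow> bool" where
  "absolute_left_derived C L P D K LK \<alpha> \<longleftrightarrow>
     left_derived C L P D K LK \<alpha> \<and>
     (\<forall>(E :: ('o, 'm) category) H. is_functor D E H \<longrightarrow>
        left_derived C L P E (H \<circ>\<^bsub>C\<^esub> K) (H \<circ>\<^bsub>L\<^esub> LK) (H \<star>L\<^bsub>C\<^esub> \<alpha>))"

text \<open>\<open>P : C \<rightarrow> L\<close> and \<open>P' : C' \<rightarrow> L'\<close> are the localization functors and \<open>F : C \<rightarrow> C'\<close> is the functor
  to be derived.\<close>

definition absolute_total_right_derived ::
    "('o, 'm) category \<Rightarrow> ('o, 'm) category \<Rightarrow> ('o, 'm) functor_data \<Rightarrow>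
     ('o, 'm) category \<Rightarrow> ('o, 'm) category \<Rightarrow> ('o, 'm) functor_data \<Rightarrow>
     ('o, 'm) functor_data \<Rightarrow> ('o, 'm) functor_data \<Rightarrow> ('o \<Rightarrow> 'm) \<Rightarrow> bool" where
  "absolute_total_right_derived C L P C' L' P' F RF \<alpha> \<longleftrightarrow>
     is_functor C C' F \<and> absolute_right_derived C L P L' (P' \<circ>\<^bsub>C\<^esub> F) RF \<alpha>"

definition absolute_total_left_derived ::
    "('o, 'm) category \<Rightarrow> ('o, 'm) category \<Rightarrow> ('o, 'm) functor_data \<Rightarrow>
     ('o, 'm) category \<Rightarrow> ('o, 'm) category \<Rightarrow> ('o, 'm) functor_data \<Rightarrow>
     ('o, 'm) functor_data \<Rightarrow> ('o, 'm) functor_data \<Rightarrow> ('o \<Rightarrow> 'm) \<Rightarrow> bool" where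
  "absolute_total_left_derived C L P C' L' P' F LF \<alpha> \<longleftrightarrow>
     is_functor C C' F \<and> absolute_left_derived C L P L' (P' \<circ>\<^bsub>C\<^esub> F) LF \<alpha>"

end

theory Submission
  imports Defs
begin

text \<open>
  Absoluteness is needed only for \<open>H = LF\<close> and \<open>H = RG\<close>: since \<open>(LF \<circ> RG, LF \<star> \<beta>)\<close> is a right derived
  functor of \<open>LF \<circ> P \<circ> G\<close>, the transformation \<open>(P' \<star> \<epsilon>)(\<alpha> \<star> G)\<close> with values in \<open>P' = \<one> \<circ> P'\<close> factors
  through \<open>LF \<star> \<beta>\<close>, which defines the counit; the unit is obtained dually. The triangle identities are
  equalities of endomorphisms of \<open>LF\<close> and \<open>RG\<close>, so by uniqueness they may be checked after
  composing with \<open>\<alpha>\<close> and \<open>\<beta>\<close>, where they reduce to the triangle identities of the given adjunction.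
\<close>

section \<open>Functors and natural transformations\<close>

text \<open>Serves to replace one commuting square inside a right-nested composite: both sides are
  reassociated so that the equal pairs stand together. The middle objects \<open>y\<close> and
  \<open>y'\<close> may differ, as they do for naturality squares.\<close>

lemma (in category) Comp_left_commute:
  assumes "f \<cdot> g = f' \<cdot> g'"
    and "f \<in> hom C y z" "g \<in> hom C x y" "f' \<in> hom C y' z" "g' \<in> hom C x y'" "h \<in> hom C w x"
  shows "f \<cdot> (g \<cdot> h) = f' \<cdot> (g' \<cdot> h)"
  by (simp add: assms(1) Comp_assoc[OF assms(2,3,6), symmetric] Comp_assoc[OF assms(4-6), symmetric])

lemma homI: "f \<in> Arr C \<Longrightarrow> f \<in> hom C (Dom C f) (Cod C f)"
  by (simp add: hom_def)

lemma hom_Obj: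
  assumes "category C" "f \<in> hom C x y"
  shows "x \<in> Obj C" "y \<in> Obj C"
  using assms category.Dom_closed[of C f] category.Cod_closed[of C f] by (auto simp: hom_def)

section \<open>Functors: hom-set form of the axioms, identities, composition, strict laws\<close>

lemma functor_categories:
  assumes "is_functor C D F"
  shows "category C" "category D"
  using assms by (auto simp: is_functor_def)

lemma functor_Obj: "is_functor C D F \<Longrightarrow> x \<in> Obj C \<Longrightarrow> OMap F x \<in> Obj D"
  by (auto simp: is_functor_def)

lemma functor_hom: "is_functor C D F \<Longrightarrow> f \<in> hom C x y \<Longrightarrow> AMap F f \<in> hom D (OMap F x) (OMap F y)"
  by (auto simp: is_functor_def hom_def)

lemma functor_Id: "is_functor C D F \<Longrightarrow> x \<in> Obj C \<Longrightarrow> AMap F (Id C x) = Id D (OMap F x)"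
  by (auto simp: is_functor_def)

lemma functor_Comp:
  "is_functor C D F \<Longrightarrow> g \<in> hom C y z \<Longrightarrow> f \<in> hom C x y \<Longrightarrow>
    AMap F (g \<cdot>\<^bsub>C\<^esub> f) = AMap F g \<cdot>\<^bsub>D\<^esub> AMap F f"
  by (auto simp: is_functor_def hom_def)

lemma is_functorI:
  assumes "category C" "category D"
    and "OMap F \<in> extensional (Obj C)" "AMap F \<in> extensional (Arr C)"
    and "\<And>x. x \<in> Obj C \<Longrightarrow> OMap F x \<in> Obj D"
    and "\<And>f x y. f \<in> hom C x y \<Longrightarrow> AMap F f \<in> hom D (OMap F x) (OMap F y)"
    and "\<And>x. x \<in> Obj C \<Longrightarrow> AMap F (Id C x) = Id D (OMap F x)"
    and "\<And>g f x y z. g \<in> hom C y z \<Longrightarrow> f \<in> hom C x y \<Longrightarrow>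
          AMap F (g \<cdot>\<^bsub>C\<^esub> f) = AMap F g \<cdot>\<^bsub>D\<^esub> AMap F f"
  shows "is_functor C D F"
  unfolding is_functor_def
proof (intro conjI ballI impI)
  fix g f assume "g \<in> Arr C" "f \<in> Arr C" "Dom C g = Cod C f"
  then show "AMap F (g \<cdot>\<^bsub>C\<^esub> f) = AMap F g \<cdot>\<^bsub>D\<^esub> AMap F f"
    by (intro assms(8)[of g "Cod C f" "Cod C g" f "Dom C f"]) (simp_all add: hom_def)
qed (auto intro: assms(1-7) homI)

lemma OMap_comp_functor [simp]: "x \<in> Obj C \<Longrightarrow> OMap (G \<circ>\<^bsub>C\<^esub> F) x = OMap G (OMap F x)"
  by (simp add: comp_functor_def)

text \<open>The endpoints occur only in the premise, so the simplifier must find them in a hom-set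
  fact at hand. Later calculations pass such facts along for this purpose.\<close>

lemma AMap_comp_functor [simp]: "f \<in> hom C x y \<Longrightarrow> AMap (G \<circ>\<^bsub>C\<^esub> F) f = AMap G (AMap F f)"
  by (simp add: comp_functor_def hom_def)

lemma OMap_id_functor [simp]: "x \<in> Obj C \<Longrightarrow> OMap \<one>\<^bsub>C\<^esub> x = x"
  by (simp add: id_functor_def)

lemma AMap_id_functor [simp]: "f \<in> hom C x y \<Longrightarrow> AMap \<one>\<^bsub>C\<^esub> f = f"
  by (simp add: id_functor_def hom_def)

lemma is_functor_id:
  assumes "category C" shows "is_functor C C \<one>\<^bsub>C\<^esub>"
proof (rule is_functorI)
  fix f x y assume f: "f \<in> hom C x y"
  then show "AMap \<one>\<^bsub>C\<^esub> f \<in> hom C (OMap \<one>\<^bsub>C\<^esub> x) (OMap \<one>\<^bsub>C\<^esub> y)"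
    using hom_Obj[OF assms f] by simp
next
  fix g f x y z assume "g \<in> hom C y z" "f \<in> hom C x y"
  then show "AMap \<one>\<^bsub>C\<^esub> (g \<cdot>\<^bsub>C\<^esub> f) = AMap \<one>\<^bsub>C\<^esub> g \<cdot>\<^bsub>C\<^esub> AMap \<one>\<^bsub>C\<^esub> f"
    using category.Comp_closed[OF assms] by (metis AMap_id_functor)
next
  fix x assume "x \<in> Obj C"
  then show "AMap \<one>\<^bsub>C\<^esub> (Id C x) = Id C (OMap \<one>\<^bsub>C\<^esub> x)"
    using category.Id_closed[OF assms] by (metis AMap_id_functor OMap_id_functor)
qed (use assms in \<open>auto simp: id_functor_def\<close>)

lemma is_functor_comp:
  assumes F: "is_functor C D F" and G: "is_functor D E G"
  shows "is_functor C E (G \<circ>\<^bsub>C\<^esub> F)"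
proof (rule is_functorI)
  show C: "category C" and "category E"
    using F G by (auto dest: functor_categories)
  fix f x y assume f: "f \<in> hom C x y"
  then show "AMap (G \<circ>\<^bsub>C\<^esub> F) f \<in> hom E (OMap (G \<circ>\<^bsub>C\<^esub> F) x) (OMap (G \<circ>\<^bsub>C\<^esub> F) y)"
    using hom_Obj[OF C f] functor_hom[OF G functor_hom[OF F f]] by simp
next
  fix x assume x: "x \<in> Obj C"
  then have "Id C x \<in> hom C x x"
    using category.Id_closed functor_categories F by metis
  then show "AMap (G \<circ>\<^bsub>C\<^esub> F) (Id C x) = Id E (OMap (G \<circ>\<^bsub>C\<^esub> F) x)"
    using x functor_Obj[OF F x] by (simp add: functor_Id[OF F] functor_Id[OF G])
next
  fix g f x y z assume g: "g \<in> hom C y z" and f: "f \<in> hom C x y"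
  then have "g \<cdot>\<^bsub>C\<^esub> f \<in> hom C x z"
    using category.Comp_closed functor_categories F by metis
  then show "AMap (G \<circ>\<^bsub>C\<^esub> F) (g \<cdot>\<^bsub>C\<^esub> f) = AMap (G \<circ>\<^bsub>C\<^esub> F) g \<cdot>\<^bsub>E\<^esub> AMap (G \<circ>\<^bsub>C\<^esub> F) f"
    using g f
    by (simp add: functor_Comp[OF F g f] functor_Comp[OF G functor_hom[OF F g] functor_hom[OF F f]])
qed (use functor_Obj[OF F] functor_Obj[OF G] in \<open>auto simp: comp_functor_def\<close>)

text \<open>Associativity holds as an equality of functors: both sides are restricted to
  \<open>C\<close>, and the inner restriction to \<open>D\<close> on the left is invisible because
  \<open>F\<close> lands in \<open>D\<close>. This lets whiskered transformations be composed
  without coherence isomorphisms.\<close>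

lemma comp_functor_assoc:
  assumes "is_functor C D F"
  shows "(H \<circ>\<^bsub>D\<^esub> G) \<circ>\<^bsub>C\<^esub> F = H \<circ>\<^bsub>C\<^esub> (G \<circ>\<^bsub>C\<^esub> F)"
proof -
  have "AMap F f \<in> Arr D" if "f \<in> Arr C" for f
    using functor_hom[OF assms homI[OF that]] by (simp add: hom_def)
  then show ?thesis
    using functor_Obj[OF assms] by (auto simp: comp_functor_def restrict_def)
qed

text \<open>Equality outside the objects and arrows of \<open>C\<close> comes from extensionality of
  \<open>F\<close>, since the composites are restricted there.\<close>

lemma comp_id_functor:
  assumes "is_functor C D F"
  shows "\<one>\<^bsub>D\<^esub> \<circ>\<^bsub>C\<^esub> F = F" "F \<circ>\<^bsub>C\<^esub> \<one>\<^bsub>C\<^esub> = F"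
proof -
  have "AMap F f \<in> Arr D" if "f \<in> Arr C" for f
    using functor_hom[OF assms homI[OF that]] by (simp add: hom_def)
  moreover have "OMap F \<in> extensional (Obj C)" "AMap F \<in> extensional (Arr C)"
    using assms by (auto simp: is_functor_def)
  ultimately show "\<one>\<^bsub>D\<^esub> \<circ>\<^bsub>C\<^esub> F = F" "F \<circ>\<^bsub>C\<^esub> \<one>\<^bsub>C\<^esub> = F"
    using functor_Obj[OF assms]
    by (cases F; auto simp: comp_functor_def id_functor_def restrict_def extensional_def fun_eq_iff)+
qed

section \<open>Natural transformations, vertical composition and whiskering\<close>

lemma nat_trans_functors:
  assumes "nat_trans C D S T \<tau>"
  shows "is_functor C D S" "is_functor C D T"
  using assms by (auto simp: nat_trans_def)

lemma nat_trans_hom: "nat_trans C D S T \<tau> \<Longrightarrow> x \<in> Obj C \<Longrightarrow> \<tau> x \<in> hom D (OMap S x) (OMap T x)"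
  by (auto simp: nat_trans_def)

lemma nat_trans_natural:
  "nat_trans C D S T \<tau> \<Longrightarrow> f \<in> hom C x y \<Longrightarrow> \<tau> y \<cdot>\<^bsub>D\<^esub> AMap S f = AMap T f \<cdot>\<^bsub>D\<^esub> \<tau> x"
  by (auto simp: nat_trans_def hom_def)

lemma nat_transI:
  assumes "is_functor C D S" "is_functor C D T" "\<tau> \<in> extensional (Obj C)"
    and "\<And>x. x \<in> Obj C \<Longrightarrow> \<tau> x \<in> hom D (OMap S x) (OMap T x)"
    and "\<And>f x y. f \<in> hom C x y \<Longrightarrow> \<tau> y \<cdot>\<^bsub>D\<^esub> AMap S f = AMap T f \<cdot>\<^bsub>D\<^esub> \<tau> x"
  shows "nat_trans C D S T \<tau>"
  unfolding nat_trans_def using assms(1-4) assms(5)[OF homI] by blast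

lemma id_trans_apply [simp]: "x \<in> Obj C \<Longrightarrow> id_trans C D S x = Id D (OMap S x)"
  by (simp add: id_trans_def)

lemma vcomp_apply [simp]: "x \<in> Obj C \<Longrightarrow> (\<sigma> \<bullet>\<^bsub>C,D\<^esub> \<tau>) x = \<sigma> x \<cdot>\<^bsub>D\<^esub> \<tau> x"
  by (simp add: vcomp_def)

lemma whisker_left_apply [simp]: "x \<in> Obj C \<Longrightarrow> (H \<star>L\<^bsub>C\<^esub> \<tau>) x = AMap H (\<tau> x)"
  by (simp add: whisker_left_def)

lemma whisker_right_apply [simp]: "x \<in> Obj C \<Longrightarrow> (\<tau> \<star>R\<^bsub>C\<^esub> P) x = \<tau> (OMap P x)"
  by (simp add: whisker_right_def)

lemma nat_trans_id:
  assumes S: "is_functor C D S"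
  shows "nat_trans C D S S (id_trans C D S)"
proof -
  interpret C: category C using functor_categories[OF S] by simp
  interpret D: category D using functor_categories[OF S] by simp
  show ?thesis
  proof (rule nat_transI)
    fix f x y assume f: "f \<in> hom C x y"
    then show "id_trans C D S y \<cdot>\<^bsub>D\<^esub> AMap S f = AMap S f \<cdot>\<^bsub>D\<^esub> id_trans C D S x"
      using hom_Obj[OF C.category_axioms f] functor_hom[OF S f] by (simp add: D.Id_left D.Id_right)
  qed (use S functor_Obj[OF S] D.Id_closed in \<open>auto simp: id_trans_def\<close>)
qed

lemma nat_trans_vcomp:
  assumes \<sigma>: "nat_trans C D S T \<sigma>" and \<tau>: "nat_trans C D R S \<tau>"
  shows "nat_trans C D R T (\<sigma> \<bullet>\<^bsub>C,D\<^esub> \<tau>)"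
proof -
  note fs = nat_trans_functors[OF \<sigma>] nat_trans_functors[OF \<tau>]
  interpret C: category C using functor_categories[OF fs(1)] by simp
  interpret D: category D using functor_categories[OF fs(1)] by simp
  show ?thesis
  proof (rule nat_transI)
    fix f x y assume f: "f \<in> hom C x y"
    note [simp] = hom_Obj[OF C.category_axioms f]
    note hs = functor_hom[OF fs(1) f] functor_hom[OF fs(2) f] functor_hom[OF fs(3) f]
      nat_trans_hom[OF \<sigma>, of x] nat_trans_hom[OF \<sigma>, of y]
      nat_trans_hom[OF \<tau>, of x] nat_trans_hom[OF \<tau>, of y]
    \<comment> \<open>The naturality squares of \<tau> and \<sigma> at \<open>f\<close> are pasted
      along \<open>AMap S f\<close>.\<close>
    have "\<sigma> y \<cdot>\<^bsub>D\<^esub> \<tau> y \<cdot>\<^bsub>D\<^esub> AMap R f = \<sigma> y \<cdot>\<^bsub>D\<^esub> (\<tau> y \<cdot>\<^bsub>D\<^esub> AMap R f)"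
      using hs by (simp add: D.Comp_assoc)
    also have "\<dots> = \<sigma> y \<cdot>\<^bsub>D\<^esub> AMap S f \<cdot>\<^bsub>D\<^esub> \<tau> x"
      using hs by (simp add: D.Comp_assoc nat_trans_natural[OF \<tau> f])
    also have "\<dots> = AMap T f \<cdot>\<^bsub>D\<^esub> (\<sigma> x \<cdot>\<^bsub>D\<^esub> \<tau> x)"
      using hs by (simp add: D.Comp_assoc nat_trans_natural[OF \<sigma> f])
    finally show "(\<sigma> \<bullet>\<^bsub>C,D\<^esub> \<tau>) y \<cdot>\<^bsub>D\<^esub> AMap R f = AMap T f \<cdot>\<^bsub>D\<^esub> (\<sigma> \<bullet>\<^bsub>C,D\<^esub> \<tau>) x"
      by simp
  qed (use fs D.Comp_closed[OF nat_trans_hom[OF \<sigma>] nat_trans_hom[OF \<tau>]] in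
      \<open>auto simp: vcomp_def\<close>)
qed

lemma nat_trans_whisker_left:
  assumes \<tau>: "nat_trans C D S T \<tau>" and H: "is_functor D E H"
  shows "nat_trans C E (H \<circ>\<^bsub>C\<^esub> S) (H \<circ>\<^bsub>C\<^esub> T) (H \<star>L\<^bsub>C\<^esub> \<tau>)"
proof -
  note fs = nat_trans_functors[OF \<tau>]
  have C: "category C" using functor_categories[OF fs(1)] by simp
  show ?thesis
  proof (rule nat_transI)
    fix f x y assume f: "f \<in> hom C x y"
    note [simp] = hom_Obj[OF C f]
    have "AMap H (\<tau> y \<cdot>\<^bsub>D\<^esub> AMap S f) = AMap H (AMap T f \<cdot>\<^bsub>D\<^esub> \<tau> x)"
      by (simp add: nat_trans_natural[OF \<tau> f])
    then have "AMap H (\<tau> y) \<cdot>\<^bsub>E\<^esub> AMap H (AMap S f) = AMap H (AMap T f) \<cdot>\<^bsub>E\<^esub> AMap H (\<tau> x)"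
      using functor_Comp[OF H nat_trans_hom[OF \<tau>] functor_hom[OF fs(1) f]]
        functor_Comp[OF H functor_hom[OF fs(2) f] nat_trans_hom[OF \<tau>]] by simp
    then show "(H \<star>L\<^bsub>C\<^esub> \<tau>) y \<cdot>\<^bsub>E\<^esub> AMap (H \<circ>\<^bsub>C\<^esub> S) f = AMap (H \<circ>\<^bsub>C\<^esub> T) f \<cdot>\<^bsub>E\<^esub> (H \<star>L\<^bsub>C\<^esub> \<tau>) x"
      using f by simp
  qed (use is_functor_comp[OF fs(1) H] is_functor_comp[OF fs(2) H]
        functor_hom[OF H nat_trans_hom[OF \<tau>]] in \<open>auto simp: whisker_left_def\<close>)
qed

lemma nat_trans_whisker_right:
  assumes \<tau>: "nat_trans D E S T \<tau>" and P: "is_functor C D P"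
  shows "nat_trans C E (S \<circ>\<^bsub>C\<^esub> P) (T \<circ>\<^bsub>C\<^esub> P) (\<tau> \<star>R\<^bsub>C\<^esub> P)"
proof -
  note fs = nat_trans_functors[OF \<tau>]
  have C: "category C" using functor_categories[OF P] by simp
  show ?thesis
  proof (rule nat_transI)
    fix f x y assume f: "f \<in> hom C x y"
    then show "(\<tau> \<star>R\<^bsub>C\<^esub> P) y \<cdot>\<^bsub>E\<^esub> AMap (S \<circ>\<^bsub>C\<^esub> P) f = AMap (T \<circ>\<^bsub>C\<^esub> P) f \<cdot>\<^bsub>E\<^esub> (\<tau> \<star>R\<^bsub>C\<^esub> P) x"
      using hom_Obj[OF C f] nat_trans_natural[OF \<tau> functor_hom[OF P f]] by simp
  qed (use is_functor_comp[OF P fs(1)] is_functor_comp[OF P fs(2)]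
        nat_trans_hom[OF \<tau> functor_Obj[OF P]] in \<open>auto simp: whisker_right_def\<close>)
qed

section \<open>Derived functors\<close>

lemma left_derived_unique_factor:
  assumes "left_derived C L P D K LK \<alpha>" "is_functor L D T" "nat_trans C D (T \<circ>\<^bsub>C\<^esub> P) K \<gamma>"
  shows "\<exists>!\<delta>. nat_trans L D T LK \<delta> \<and> \<gamma> = \<alpha> \<bullet>\<^bsub>C,D\<^esub> (\<delta> \<star>R\<^bsub>C\<^esub> P)"
  using assms by (simp add: left_derived_def)

lemma right_derived_unique_factor:
  assumes "right_derived C L P D K RK \<beta>" "is_functor L D T" "nat_trans C D K (T \<circ>\<^bsub>C\<^esub> P) \<gamma>"
  shows "\<exists>!\<delta>. nat_trans L D RK T \<delta> \<and> \<gamma> = (\<delta> \<star>R\<^bsub>C\<^esub> P) \<bullet>\<^bsub>C,D\<^esub> \<beta>"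
  using assms by (simp add: right_derived_def)

text \<open>The composite of \<alpha> with \<sigma> whiskered by \<open>P\<close> is itself a
  transformation from \<open>T\<close> after \<open>P\<close> to \<open>K\<close>, so the universal
  property gives it exactly one factorization, and by \<open>eq\<close> both \<sigma> and \<tau>
  provide one. Thus agreement needs to be tested only at objects \<open>OMap P x\<close>, after
  composing with \<alpha>.\<close>

lemma left_derived_eqI:
  assumes ld: "left_derived C L P D K LK \<alpha>" and P: "is_functor C L P"
    and \<sigma>: "nat_trans L D T LK \<sigma>" and \<tau>: "nat_trans L D T LK \<tau>"
    and eq: "\<And>x. x \<in> Obj C \<Longrightarrow> \<alpha> x \<cdot>\<^bsub>D\<^esub> \<sigma> (OMap P x) = \<alpha> x \<cdot>\<^bsub>D\<^esub> \<tau> (OMap P x)"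
  shows "\<sigma> = \<tau>"
proof -
  have "nat_trans C D (LK \<circ>\<^bsub>C\<^esub> P) K \<alpha>"
    using ld by (simp add: left_derived_def)
  from nat_trans_vcomp[OF this nat_trans_whisker_right[OF \<sigma> P]]
  have ex1: "\<exists>!\<delta>. nat_trans L D T LK \<delta> \<and> \<alpha> \<bullet>\<^bsub>C,D\<^esub> (\<sigma> \<star>R\<^bsub>C\<^esub> P) = \<alpha> \<bullet>\<^bsub>C,D\<^esub> (\<delta> \<star>R\<^bsub>C\<^esub> P)"
    by (rule left_derived_unique_factor[OF ld nat_trans_functors(1)[OF \<sigma>]])
  have "\<alpha> \<bullet>\<^bsub>C,D\<^esub> (\<sigma> \<star>R\<^bsub>C\<^esub> P) = \<alpha> \<bullet>\<^bsub>C,D\<^esub> (\<tau> \<star>R\<^bsub>C\<^esub> P)"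
    using eq by (auto simp: vcomp_def)
  then show ?thesis
    by (rule_tac Uniq_D[OF ex1_iff_ex_Uniq[THEN iffD1, OF ex1, THEN conjunct2]]) (simp_all add: \<sigma> \<tau>)
qed

text \<open>Dual argument: \<sigma> and \<tau> are both factorizations of the same transformation
  from \<open>K\<close> through \<beta>.\<close>

lemma right_derived_eqI:
  assumes rd: "right_derived C L P D K RK \<beta>" and P: "is_functor C L P"
    and \<sigma>: "nat_trans L D RK T \<sigma>" and \<tau>: "nat_trans L D RK T \<tau>"
    and eq: "\<And>x. x \<in> Obj C \<Longrightarrow> \<sigma> (OMap P x) \<cdot>\<^bsub>D\<^esub> \<beta> x = \<tau> (OMap P x) \<cdot>\<^bsub>D\<^esub> \<beta> x"
  shows "\<sigma> = \<tau>"
proof -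
  have "nat_trans C D K (RK \<circ>\<^bsub>C\<^esub> P) \<beta>"
    using rd by (simp add: right_derived_def)
  from nat_trans_vcomp[OF nat_trans_whisker_right[OF \<sigma> P] this]
  have ex1: "\<exists>!\<delta>. nat_trans L D RK T \<delta> \<and> (\<sigma> \<star>R\<^bsub>C\<^esub> P) \<bullet>\<^bsub>C,D\<^esub> \<beta> = (\<delta> \<star>R\<^bsub>C\<^esub> P) \<bullet>\<^bsub>C,D\<^esub> \<beta>"
    by (rule right_derived_unique_factor[OF rd nat_trans_functors(2)[OF \<sigma>]])
  have "(\<sigma> \<star>R\<^bsub>C\<^esub> P) \<bullet>\<^bsub>C,D\<^esub> \<beta> = (\<tau> \<star>R\<^bsub>C\<^esub> P) \<bullet>\<^bsub>C,D\<^esub> \<beta>"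
    using eq by (auto simp: vcomp_def)
  then show ?thesis
    by (rule_tac Uniq_D[OF ex1_iff_ex_Uniq[THEN iffD1, OF ex1, THEN conjunct2]]) (simp_all add: \<sigma> \<tau>)
qed

theorem mainTheorem1:
  fixes C C' L L' :: "('o, 'm) category"
    and W W' :: "'m set"
    and P P' F G LF RG :: "('o, 'm) functor_data"
    and \<epsilon> \<eta> \<alpha> \<beta> :: "'o \<Rightarrow> 'm"
  assumes "localizer C W" and "localizer C' W'"
    and "is_localization C W L P" and "is_localization C' W' L' P'"
    and "adjunction C C' F G \<eta> \<epsilon>"
    and "absolute_total_left_derived C L P C' L' P' F LF \<alpha>"
    and "absolute_total_right_derived C' L' P' C L P G RG \<beta>"
  shows "\<exists>\<eta>' \<epsilon>'.
    adjunction L L' LF RG \<eta>' \<epsilon>' \<and>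
    (\<epsilon>' \<star>R\<^bsub>C'\<^esub> P') \<bullet>\<^bsub>C',L'\<^esub> (LF \<star>L\<^bsub>C'\<^esub> \<beta>) = (P' \<star>L\<^bsub>C'\<^esub> \<epsilon>) \<bullet>\<^bsub>C',L'\<^esub> (\<alpha> \<star>R\<^bsub>C'\<^esub> G) \<and>
    (RG \<star>L\<^bsub>C\<^esub> \<alpha>) \<bullet>\<^bsub>C,L\<^esub> (\<eta>' \<star>R\<^bsub>C\<^esub> P) = (\<beta> \<star>R\<^bsub>C\<^esub> F) \<bullet>\<^bsub>C,L\<^esub> (P \<star>L\<^bsub>C\<^esub> \<eta>)"
proof -

  \<comment> \<open>The functors, transformations and universal properties given by the
    hypotheses\<close>
  have P: "is_functor C L P" and P': "is_functor C' L' P'"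
    using assms(3,4) by (auto simp: is_localization_def)
  have F: "is_functor C C' F" and G: "is_functor C' C G"
    and \<eta>: "nat_trans C C \<one>\<^bsub>C\<^esub> (G \<circ>\<^bsub>C\<^esub> F) \<eta>" and \<epsilon>: "nat_trans C' C' (F \<circ>\<^bsub>C'\<^esub> G) \<one>\<^bsub>C'\<^esub> \<epsilon>"
    and tF: "(\<epsilon> \<star>R\<^bsub>C\<^esub> F) \<bullet>\<^bsub>C,C'\<^esub> (F \<star>L\<^bsub>C\<^esub> \<eta>) = id_trans C C' F"
    and tG: "(G \<star>L\<^bsub>C'\<^esub> \<epsilon>) \<bullet>\<^bsub>C',C\<^esub> (\<eta> \<star>R\<^bsub>C'\<^esub> G) = id_trans C' C G"
    using assms(5) by (auto simp: adjunction_def)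
  have ld: "left_derived C L P L' (P' \<circ>\<^bsub>C\<^esub> F) LF \<alpha>"
    and rd: "right_derived C' L' P' L (P \<circ>\<^bsub>C'\<^esub> G) RG \<beta>"
    using assms(6,7) by (auto simp: absolute_total_left_derived_def absolute_left_derived_def
        absolute_total_right_derived_def absolute_right_derived_def)
  have LF: "is_functor L L' LF" and RG: "is_functor L' L RG"
    and \<alpha>: "nat_trans C L' (LF \<circ>\<^bsub>C\<^esub> P) (P' \<circ>\<^bsub>C\<^esub> F) \<alpha>"
    and \<beta>: "nat_trans C' L (P \<circ>\<^bsub>C'\<^esub> G) (RG \<circ>\<^bsub>C'\<^esub> P') \<beta>"
    using ld rd by (auto simp: left_derived_def right_derived_def)
  have rd': "right_derived C' L' P' L' (LF \<circ>\<^bsub>C'\<^esub> (P \<circ>\<^bsub>C'\<^esub> G)) (LF \<circ>\<^bsub>L'\<^esub> RG) (LF \<star>L\<^bsub>C'\<^esub> \<beta>)"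
    and ld': "left_derived C L P L (RG \<circ>\<^bsub>C\<^esub> (P' \<circ>\<^bsub>C\<^esub> F)) (RG \<circ>\<^bsub>L\<^esub> LF) (RG \<star>L\<^bsub>C\<^esub> \<alpha>)"
    using assms(6,7) LF RG by (auto simp: absolute_total_left_derived_def absolute_left_derived_def
        absolute_total_right_derived_def absolute_right_derived_def)
  interpret C: category C using functor_categories[OF P] by simp
  interpret L: category L using functor_categories[OF P] by simp
  interpret C': category C' using functor_categories[OF P'] by simp
  interpret L': category L' using functor_categories[OF P'] by simp

  \<comment> \<open>Construction of the derived counit and unit\<close>
  have "nat_trans C' L' (LF \<circ>\<^bsub>C'\<^esub> (P \<circ>\<^bsub>C'\<^esub> G)) (\<one>\<^bsub>L'\<^esub> \<circ>\<^bsub>C'\<^esub> P') ((P' \<star>L\<^bsub>C'\<^esub> \<epsilon>) \<bullet>\<^bsub>C',L'\<^esub> (\<alpha> \<star>R\<^bsub>C'\<^esub> G))"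
    using nat_trans_vcomp[of C' L' "P' \<circ>\<^bsub>C'\<^esub> (F \<circ>\<^bsub>C'\<^esub> G)" P' "P' \<star>L\<^bsub>C'\<^esub> \<epsilon>"]
      nat_trans_whisker_left[OF \<epsilon> P'] nat_trans_whisker_right[OF \<alpha> G]
    by (simp add: comp_functor_assoc[OF G] comp_id_functor[OF P'])
  \<comment> \<open>The universal property of \<open>rd'\<close> is applied with \<open>T\<close>
    the identity functor of \<open>L'\<close>, which is why the target was written as a composite
    with \<open>P'\<close>. The factorization equation is the required compatibility of the
    counit.\<close>
  then obtain \<epsilon>' where \<epsilon>': "nat_trans L' L' (LF \<circ>\<^bsub>L'\<^esub> RG) \<one>\<^bsub>L'\<^esub> \<epsilon>'"
    and \<epsilon>'_eq: "(P' \<star>L\<^bsub>C'\<^esub> \<epsilon>) \<bullet>\<^bsub>C',L'\<^esub> (\<alpha> \<star>R\<^bsub>C'\<^esub> G) = (\<epsilon>' \<star>R\<^bsub>C'\<^esub> P') \<bullet>\<^bsub>C',L'\<^esub> (LF \<star>L\<^bsub>C'\<^esub> \<beta>)"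
    using right_derived_unique_factor[OF rd' is_functor_id[OF L'.category_axioms]] by blast
  have "nat_trans C L (\<one>\<^bsub>L\<^esub> \<circ>\<^bsub>C\<^esub> P) (RG \<circ>\<^bsub>C\<^esub> (P' \<circ>\<^bsub>C\<^esub> F)) ((\<beta> \<star>R\<^bsub>C\<^esub> F) \<bullet>\<^bsub>C,L\<^esub> (P \<star>L\<^bsub>C\<^esub> \<eta>))"
    using nat_trans_vcomp[of C L "P \<circ>\<^bsub>C\<^esub> (G \<circ>\<^bsub>C\<^esub> F)" _ "\<beta> \<star>R\<^bsub>C\<^esub> F" P]
      nat_trans_whisker_left[OF \<eta> P] nat_trans_whisker_right[OF \<beta> F]
    by (simp add: comp_functor_assoc[OF F] comp_id_functor[OF P])
  \<comment> \<open>Dually, \<open>ld'\<close> is applied with \<open>T\<close> the identity functor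
    of \<open>L\<close>, and the factorization equation is the compatibility of the unit.\<close>
  then obtain \<eta>' where \<eta>': "nat_trans L L \<one>\<^bsub>L\<^esub> (RG \<circ>\<^bsub>L\<^esub> LF) \<eta>'"
    and \<eta>'_eq: "(\<beta> \<star>R\<^bsub>C\<^esub> F) \<bullet>\<^bsub>C,L\<^esub> (P \<star>L\<^bsub>C\<^esub> \<eta>) = (RG \<star>L\<^bsub>C\<^esub> \<alpha>) \<bullet>\<^bsub>C,L\<^esub> (\<eta>' \<star>R\<^bsub>C\<^esub> P)"
    using left_derived_unique_factor[OF ld' is_functor_id[OF L.category_axioms]] by blast

  \<comment> \<open>Components of the transformations and of the two compatibilities\<close>
  note objs [simp] = functor_Obj[OF P] functor_Obj[OF P'] functor_Obj[OF F] functor_Obj[OF G]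
    functor_Obj[OF LF] functor_Obj[OF RG]
  have \<alpha>h: "\<alpha> x \<in> hom L' (OMap LF (OMap P x)) (OMap P' (OMap F x))"
    and \<eta>h: "\<eta> x \<in> hom C x (OMap G (OMap F x))" if "x \<in> Obj C" for x
    using nat_trans_hom[OF \<alpha> that] nat_trans_hom[OF \<eta> that] that by simp_all
  have \<beta>h: "\<beta> y \<in> hom L (OMap P (OMap G y)) (OMap RG (OMap P' y))"
    and \<epsilon>h: "\<epsilon> y \<in> hom C' (OMap F (OMap G y)) y" if "y \<in> Obj C'" for y
    using nat_trans_hom[OF \<beta> that] nat_trans_hom[OF \<epsilon> that] that by simp_all
  have \<eta>'h: "\<eta>' u \<in> hom L u (OMap RG (OMap LF u))" if "u \<in> Obj L" for u
    using nat_trans_hom[OF \<eta>' that] that by simp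
  have \<epsilon>'h: "\<epsilon>' v \<in> hom L' (OMap LF (OMap RG v)) v" if "v \<in> Obj L'" for v
    using nat_trans_hom[OF \<epsilon>' that] that by simp
  have \<epsilon>'_at: "\<epsilon>' (OMap P' y) \<cdot>\<^bsub>L'\<^esub> AMap LF (\<beta> y) = AMap P' (\<epsilon> y) \<cdot>\<^bsub>L'\<^esub> \<alpha> (OMap G y)"
    if "y \<in> Obj C'" for y
    using fun_cong[OF \<epsilon>'_eq, of y] that by simp
  have \<eta>'_at: "AMap RG (\<alpha> x) \<cdot>\<^bsub>L\<^esub> \<eta>' (OMap P x) = \<beta> (OMap F x) \<cdot>\<^bsub>L\<^esub> AMap P (\<eta> x)"
    if "x \<in> Obj C" for x
    using fun_cong[OF \<eta>'_eq, of x] that by simp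

  \<comment> \<open>Triangle identity for the left derived functor\<close>
  have LF_triangle: "(\<epsilon>' \<star>R\<^bsub>L\<^esub> LF) \<bullet>\<^bsub>L,L'\<^esub> (LF \<star>L\<^bsub>L\<^esub> \<eta>') = id_trans L L' LF"
  proof (rule left_derived_eqI[OF ld P _ nat_trans_id[OF LF]])
    show "nat_trans L L' LF LF ((\<epsilon>' \<star>R\<^bsub>L\<^esub> LF) \<bullet>\<^bsub>L,L'\<^esub> (LF \<star>L\<^bsub>L\<^esub> \<eta>'))"
      using nat_trans_vcomp nat_trans_whisker_left[OF \<eta>' LF] nat_trans_whisker_right[OF \<epsilon>' LF]
      by (simp add: comp_functor_assoc[OF LF] comp_id_functor[OF LF])
  next
    fix x assume x [simp]: "x \<in> Obj C"
    let ?a = "AMap LF (\<eta>' (OMap P x))" and ?b = "AMap LF (AMap P (\<eta> x))"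
    have a: "?a \<in> hom L' (OMap LF (OMap P x)) (OMap LF (OMap RG (OMap LF (OMap P x))))"
      using functor_hom[OF LF \<eta>'h] by simp
    have b: "?b \<in> hom L' (OMap LF (OMap P x)) (OMap LF (OMap P (OMap G (OMap F x))))"
      using functor_hom[OF LF functor_hom[OF P \<eta>h]] by simp
    note ra = functor_hom[OF RG \<alpha>h[OF x]]
    \<comment> \<open>Naturality of \<epsilon>' at the arrow \<open>\<alpha> x\<close> moves
      \<alpha> to the right of the counit, next to \<open>?a\<close>.\<close>
    have "\<alpha> x \<cdot>\<^bsub>L'\<^esub> (\<epsilon>' (OMap LF (OMap P x)) \<cdot>\<^bsub>L'\<^esub> ?a)
        = \<epsilon>' (OMap P' (OMap F x)) \<cdot>\<^bsub>L'\<^esub> (AMap LF (AMap RG (\<alpha> x)) \<cdot>\<^bsub>L'\<^esub> ?a)"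
      using nat_trans_natural[OF \<epsilon>' \<alpha>h[OF x]] \<alpha>h[OF x]
      by (intro L'.Comp_left_commute[OF _ \<alpha>h \<epsilon>'h \<epsilon>'h functor_hom[OF LF ra] a]) simp_all
    \<comment> \<open>The unit compatibility at \<open>x\<close>, with \<open>LF\<close> applied,
      trades \<eta>' for \<eta> at the price of \<beta>.\<close>
    also have "AMap LF (AMap RG (\<alpha> x)) \<cdot>\<^bsub>L'\<^esub> ?a = AMap LF (\<beta> (OMap F x)) \<cdot>\<^bsub>L'\<^esub> ?b"
      using \<eta>'_at[OF x] functor_Comp[OF LF ra \<eta>'h]
        functor_Comp[OF LF \<beta>h functor_hom[OF P \<eta>h]] by simp
    \<comment> \<open>The counit compatibility at \<open>OMap F x\<close> absorbs this \<beta> and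
      trades \<epsilon>' for \<epsilon>.\<close>
    also have "\<epsilon>' (OMap P' (OMap F x)) \<cdot>\<^bsub>L'\<^esub> (AMap LF (\<beta> (OMap F x)) \<cdot>\<^bsub>L'\<^esub> ?b)
        = AMap P' (\<epsilon> (OMap F x)) \<cdot>\<^bsub>L'\<^esub> (\<alpha> (OMap G (OMap F x)) \<cdot>\<^bsub>L'\<^esub> ?b)"
      by (intro L'.Comp_left_commute[OF \<epsilon>'_at \<epsilon>'h functor_hom[OF LF \<beta>h]
            functor_hom[OF P' \<epsilon>h] \<alpha>h b]) simp_all
    \<comment> \<open>Naturality of \<alpha> at \<open>\<eta> x\<close> brings \<alpha> to the far
      right, so that \<epsilon> and \<eta> meet under \<open>P'\<close>.\<close>
    also have "\<alpha> (OMap G (OMap F x)) \<cdot>\<^bsub>L'\<^esub> ?b = AMap P' (AMap F (\<eta> x)) \<cdot>\<^bsub>L'\<^esub> \<alpha> x"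
      using nat_trans_natural[OF \<alpha> \<eta>h[OF x]] \<eta>h[OF x] by simp
    also have "AMap P' (\<epsilon> (OMap F x)) \<cdot>\<^bsub>L'\<^esub> (AMap P' (AMap F (\<eta> x)) \<cdot>\<^bsub>L'\<^esub> \<alpha> x)
        = AMap P' (\<epsilon> (OMap F x) \<cdot>\<^bsub>C'\<^esub> AMap F (\<eta> x)) \<cdot>\<^bsub>L'\<^esub> \<alpha> x"
      using L'.Comp_assoc[OF functor_hom[OF P' \<epsilon>h] functor_hom[OF P' functor_hom[OF F \<eta>h]] \<alpha>h]
        functor_Comp[OF P' \<epsilon>h functor_hom[OF F \<eta>h]] by simp
    \<comment> \<open>The original triangle identity \<open>tF\<close> turns the arrow under
      \<open>P'\<close> into an identity.\<close>
    also have "\<dots> = \<alpha> x"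
      using fun_cong[OF tF, of x] \<alpha>h[OF x] by (simp add: functor_Id[OF P'] L'.Id_left)
    finally show "\<alpha> x \<cdot>\<^bsub>L'\<^esub> ((\<epsilon>' \<star>R\<^bsub>L\<^esub> LF) \<bullet>\<^bsub>L,L'\<^esub> (LF \<star>L\<^bsub>L\<^esub> \<eta>')) (OMap P x)
        = \<alpha> x \<cdot>\<^bsub>L'\<^esub> id_trans L L' LF (OMap P x)"
      using \<alpha>h[OF x] by (simp add: L'.Id_right)
  qed

  \<comment> \<open>Triangle identity for the right derived functor\<close>
  have RG_triangle: "(RG \<star>L\<^bsub>L'\<^esub> \<epsilon>') \<bullet>\<^bsub>L',L\<^esub> (\<eta>' \<star>R\<^bsub>L'\<^esub> RG) = id_trans L' L RG"
  proof (rule right_derived_eqI[OF rd P' _ nat_trans_id[OF RG]])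
    show "nat_trans L' L RG RG ((RG \<star>L\<^bsub>L'\<^esub> \<epsilon>') \<bullet>\<^bsub>L',L\<^esub> (\<eta>' \<star>R\<^bsub>L'\<^esub> RG))"
      using nat_trans_vcomp nat_trans_whisker_left[OF \<epsilon>' RG] nat_trans_whisker_right[OF \<eta>' RG]
      by (simp add: comp_functor_assoc[OF RG] comp_id_functor[OF RG])
  next
    fix y assume y [simp]: "y \<in> Obj C'"
    let ?a = "AMap RG (\<epsilon>' (OMap P' y))" and ?b = "AMap RG (AMap P' (\<epsilon> y))"
    let ?e = "\<eta>' (OMap P (OMap G y))"
    have a: "?a \<in> hom L (OMap RG (OMap LF (OMap RG (OMap P' y)))) (OMap RG (OMap P' y))"
      using functor_hom[OF RG \<epsilon>'h] by simp
    note rb = functor_hom[OF LF \<beta>h[OF y]] and pe = functor_hom[OF P' \<epsilon>h[OF y]]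
    have "?a \<cdot>\<^bsub>L\<^esub> \<eta>' (OMap RG (OMap P' y)) \<cdot>\<^bsub>L\<^esub> \<beta> y = ?a \<cdot>\<^bsub>L\<^esub> (\<eta>' (OMap RG (OMap P' y)) \<cdot>\<^bsub>L\<^esub> \<beta> y)"
      by (intro L.Comp_assoc[OF a \<eta>'h \<beta>h]) simp_all
    \<comment> \<open>Naturality of \<eta>' at the arrow \<open>\<beta> y\<close> places \<beta>
      next to the counit, under \<open>RG\<close>.\<close>
    also have "\<eta>' (OMap RG (OMap P' y)) \<cdot>\<^bsub>L\<^esub> \<beta> y = AMap RG (AMap LF (\<beta> y)) \<cdot>\<^bsub>L\<^esub> ?e"
      using nat_trans_natural[OF \<eta>' \<beta>h[OF y]] \<beta>h[OF y] by simp
    \<comment> \<open>Here \<open>RG\<close> is applied to the counit compatibility at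
      \<open>y\<close>; the resulting \<alpha> is then absorbed by the unit compatibility at
      \<open>OMap G y\<close>.\<close>
    also have "?a \<cdot>\<^bsub>L\<^esub> (AMap RG (AMap LF (\<beta> y)) \<cdot>\<^bsub>L\<^esub> ?e) = ?b \<cdot>\<^bsub>L\<^esub> (AMap RG (\<alpha> (OMap G y)) \<cdot>\<^bsub>L\<^esub> ?e)"
      using \<epsilon>'_at[OF y] functor_Comp[OF RG \<epsilon>'h rb] functor_Comp[OF RG pe \<alpha>h]
      by (intro L.Comp_left_commute[OF _ a functor_hom[OF RG rb] functor_hom[OF RG pe]
            functor_hom[OF RG \<alpha>h] \<eta>'h]) simp_all
    also have "AMap RG (\<alpha> (OMap G y)) \<cdot>\<^bsub>L\<^esub> ?e = \<beta> (OMap F (OMap G y)) \<cdot>\<^bsub>L\<^esub> AMap P (\<eta> (OMap G y))"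
      by (simp add: \<eta>'_at)
    \<comment> \<open>Naturality of \<beta> at \<open>\<epsilon> y\<close> brings \<beta> to the far
      left, leaving under \<open>P\<close> the composite that \<open>tG\<close> makes an
      identity.\<close>
    also have "?b \<cdot>\<^bsub>L\<^esub> (\<beta> (OMap F (OMap G y)) \<cdot>\<^bsub>L\<^esub> AMap P (\<eta> (OMap G y)))
        = \<beta> y \<cdot>\<^bsub>L\<^esub> (AMap P (AMap G (\<epsilon> y)) \<cdot>\<^bsub>L\<^esub> AMap P (\<eta> (OMap G y)))"
      using nat_trans_natural[OF \<beta> \<epsilon>h[OF y]] \<epsilon>h[OF y]
      by (intro L.Comp_left_commute[OF _ functor_hom[OF RG pe] \<beta>h \<beta>h
            functor_hom[OF P functor_hom[OF G \<epsilon>h]] functor_hom[OF P \<eta>h]]) simp_all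
    also have "AMap P (AMap G (\<epsilon> y)) \<cdot>\<^bsub>L\<^esub> AMap P (\<eta> (OMap G y)) = AMap P (AMap G (\<epsilon> y) \<cdot>\<^bsub>C\<^esub> \<eta> (OMap G y))"
      using functor_Comp[OF P functor_hom[OF G \<epsilon>h] \<eta>h] by simp
    also have "\<beta> y \<cdot>\<^bsub>L\<^esub> \<dots> = \<beta> y"
      using fun_cong[OF tG, of y] \<beta>h[OF y] by (simp add: functor_Id[OF P] L.Id_right)
    finally show "((RG \<star>L\<^bsub>L'\<^esub> \<epsilon>') \<bullet>\<^bsub>L',L\<^esub> (\<eta>' \<star>R\<^bsub>L'\<^esub> RG)) (OMap P' y) \<cdot>\<^bsub>L\<^esub> \<beta> y
        = id_trans L' L RG (OMap P' y) \<cdot>\<^bsub>L\<^esub> \<beta> y"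
      using \<beta>h[OF y] by (simp add: L.Id_left)
  qed

  have "adjunction L L' LF RG \<eta>' \<epsilon>'"
    using LF RG \<eta>' \<epsilon>' LF_triangle RG_triangle by (simp add: adjunction_def)
  then show ?thesis
    using \<epsilon>'_eq \<eta>'_eq by metis
qed

end
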